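(* Let four pairwise distinct generalized circles be given in the plane (completed by the point $\infty$), not all of which are tangent at one and the same point. Then there exist at most $6$ generalized circles that are tangent to each of the four given ones.
   Context: The plane is completed by one point at infinity $\infty$, through which every line passes. A generalized circle is a circle, a line (together with $\infty$), or a point (the point $\infty$ is allowed). Two generalized circles are called tangent (in the generalized sense) if one of the following holds: (1) they are two tangent circles, or a circle and a line tangent to it; (2) they are two (distinct) parallel lines (tangent at $\infty$); (3) one is a point and the other is a circle or line containing this point (tangent at that point). Generalized circles are "all tangent at one point" if there is a point $P$ (possibly $\infty$) such that any two of them are tangent at $P$. *)

theory Defs
  imports "HOL-Analysis.Analysis"
begin

datatype ext_plane = Fin "real^2" | Infty

definition ext_line :: "(real^2) set \<Rightarrow> ext_plane set" where
  "ext_line L = insert Infty (Fin ` L)"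

definition is_circle :: "ext_plane set \<Rightarrow> bool" where
  "is_circle X \<longleftrightarrow> (\<exists>c r. r > 0 \<and> X = Fin ` sphere c r)"

definition is_line :: "ext_plane set \<Rightarrow> bool" where
  "is_line X \<longleftrightarrow> (\<exists>L. affine L \<and> aff_dim L = 1 \<and> X = ext_line L)"

definition is_point :: "ext_plane set \<Rightarrow> bool" where
  "is_point X \<longleftrightarrow> (\<exists>P. X = {P})"

definition gen_circle :: "ext_plane set \<Rightarrow> bool" where
  "gen_circle X \<longleftrightarrow> is_circle X \<or> is_line X \<or> is_point X"

(* Two circles, or a circle and a line, are tangent when they have exactly one common point
   (so a circle is not tangent to itself; internal and external tangency are both included). *)
definition circle_tangent_at :: "ext_plane \<Rightarrow> ext_plane set \<Rightarrow> ext_plane set \<Rightarrow> bool" where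
  "circle_tangent_at P X Y \<longleftrightarrow> is_circle X \<and> (is_circle Y \<or> is_line Y) \<and> X \<inter> Y = {P}"

definition parallel_lines :: "ext_plane set \<Rightarrow> ext_plane set \<Rightarrow> bool" where
  "parallel_lines X Y \<longleftrightarrow> is_line X \<and> is_line Y \<and> X \<noteq> Y \<and>
     (\<exists>L M. X = ext_line L \<and> Y = ext_line M \<and> affine_parallel L M)"

definition point_tangent_at :: "ext_plane \<Rightarrow> ext_plane set \<Rightarrow> ext_plane set \<Rightarrow> bool" where
  "point_tangent_at P X Y \<longleftrightarrow> X = {P} \<and> (is_circle Y \<or> is_line Y) \<and> P \<in> Y"

definition tangent_at :: "ext_plane \<Rightarrow> ext_plane set \<Rightarrow> ext_plane set \<Rightarrow> bool" where
  "tangent_at P X Y \<longleftrightarrow>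
     circle_tangent_at P X Y \<or> circle_tangent_at P Y X \<or>
     (parallel_lines X Y \<and> P = Infty) \<or>
     point_tangent_at P X Y \<or> point_tangent_at P Y X"

definition tangent :: "ext_plane set \<Rightarrow> ext_plane set \<Rightarrow> bool" where
  "tangent X Y \<longleftrightarrow> (\<exists>P. tangent_at P X Y)"

definition all_tangent_at_one_point :: "ext_plane set set \<Rightarrow> bool" where
  "all_tangent_at_one_point S \<longleftrightarrow> (\<exists>P. pairwise (tangent_at P) S)"

end

theory Submission
  imports Defs
begin

section \<open>Generalized circles in Minkowski space\<close>

text \<open>
  A circle or line is a pair \<open>\<plusminus>x\<close> of unit vectors, and a point a null line, of a four-dimensional space
  with a form of signature \<open>(3, 1)\<close>; tangency of \<open>x\<close> and \<open>y\<close> forces \<open>(lor x y)\<^sup>2 = lor x x * lor y y\<close>.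
  Let \<open>x1, \<dots>, x4\<close> represent the given circles, say none of them a point. After normalizing
  \<open>lor y x1 = 1\<close>, a solution \<open>y\<close> that is not a point has one of eight sign patterns
  \<open>(lor y x2, lor y x3, lor y x4)\<close>.

  If the \<open>xi\<close> are independent, \<open>y\<close> is determined by its pattern, and at most six patterns occur, because
  seven would force the eighth and make the form positive definite. If they span a hyperplane, their
  linear relation leaves at most three patterns, and a pattern determines \<open>y\<close> up to a multiple of a
  vector \<open>v\<close> orthogonal to all \<open>xi\<close>, hence up to two choices. If \<open>v\<close> is null there is only one choice
  unless \<open>v\<close> is orthogonal to \<open>y\<close>, but then all \<open>xi\<close> are tangent at the point \<open>v\<close>. If they span a plane,
  any \<open>y\<close> again yields such a null vector, so only the at most two common points are left as solutions.
  Points among the given circles merely reduce the number of patterns.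
\<close>

type_synonym circle_vec = "(real^2) \<times> real \<times> real"

text \<open>Polarization of \<open>n \<bullet> n - a * d\<close>. If (n, a, d) is the equation of a
  circle, this value is \<open>a\<^sup>2\<close> times the squared radius.\<close>

definition lor :: "circle_vec \<Rightarrow> circle_vec \<Rightarrow> real" where
  "lor x y = fst x \<bullet> fst y - (fst (snd x) * snd (snd y) + fst (snd y) * snd (snd x)) / 2"

text \<open>The null lift onto a paraboloid, with \<open>Infty\<close> taking the one null direction
  whose middle coordinate is 0: one chosen vector on each null line.\<close>

fun pt :: "ext_plane \<Rightarrow> circle_vec" where
  "pt (Fin u) = (u, 1, u \<bullet> u)"
| "pt Infty = (0, 0, 1)"

text \<open>The vector \<open>(n, a, d)\<close> encodes the equation \<open>a |u|\<^sup>2 - 2 n \<bullet> u + d = 0\<close>.\<close>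

definition locus :: "circle_vec \<Rightarrow> ext_plane set" where
  "locus x = {P. lor x (pt P) = 0}"

text \<open>Curves are fixed up to sign, points by the exact lift \<open>pt P\<close>. Thus
  \<open>lor x x\<close> is 1 or 0, and tangency takes the same form for curves and points.\<close>

definition represents :: "circle_vec \<Rightarrow> ext_plane set \<Rightarrow> bool" where
  "represents x X \<longleftrightarrow> X = locus x \<and>
     (lor x x = 1 \<and> (is_circle X \<or> is_line X) \<or> (\<exists>P. x = pt P))"

section \<open>Symmetry and bilinearity of the form\<close>

lemma lor_commute: "lor x y = lor y x"
  by (simp add: lor_def inner_commute)

lemma lor_add_left: "lor (x + y) z = lor x z + lor y z"
  by (simp add: lor_def algebra_simps inner_add_left add_divide_distrib)

lemma lor_scale_left: "lor (c *\<^sub>R x) z = c * lor x z"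
  by (simp add: lor_def algebra_simps)

lemma lor_add_right: "lor z (x + y) = lor z x + lor z y"
  by (simp add: lor_commute[of z] lor_add_left)

lemma lor_scale_right: "lor z (c *\<^sub>R x) = c * lor z x"
  by (simp add: lor_commute[of z] lor_scale_left)

lemma lor_minus_left: "lor (- x) z = - lor x z"
  using lor_scale_left[of "-1"] by simp

lemma lor_minus_right: "lor z (- x) = - lor z x"
  using lor_scale_right[of _ "-1"] by simp

lemma lor_diff_left: "lor (x - y) z = lor x z - lor y z"
  using lor_add_left[of x "-y"] by (simp add: lor_minus_left)

lemma lor_diff_right: "lor z (x - y) = lor z x - lor z y"
  using lor_add_right[of _ x "-y"] by (simp add: lor_minus_right)

lemma lor_zero_left [simp]: "lor 0 z = 0"
  and lor_zero_right [simp]: "lor z 0 = 0"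
  by (simp_all add: lor_def)

lemmas lor_simps = lor_add_left lor_add_right lor_scale_left lor_scale_right
  lor_minus_left lor_minus_right lor_diff_left lor_diff_right

section \<open>Null vectors and points\<close>

lemma lor_pt_self [simp]: "lor (pt P) (pt P) = 0"
  by (cases P) (simp_all add: lor_def)

lemma pt_nonzero [simp]: "pt P \<noteq> 0"
  by (cases P) (simp_all add: zero_prod_def)

text \<open>For finite points the product is minus half the squared distance.\<close>

lemma lor_pt_pt_eq_0_iff: "lor (pt P) (pt R) = 0 \<longleftrightarrow> P = R"
proof (cases P; cases R)
  fix u w assume PR: "P = Fin u" "R = Fin w"
  have "lor (pt P) (pt R) = - ((u - w) \<bullet> (u - w)) / 2"
    by (simp add: PR lor_def inner_diff_left inner_diff_right inner_commute field_simps)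
  then show ?thesis by (simp add: PR)
qed (auto simp: lor_def)

lemma locus_pt: "locus (pt P) = {P}"
  by (auto simp: locus_def lor_pt_pt_eq_0_iff)

lemma locus_scale: "c \<noteq> 0 \<Longrightarrow> locus (c *\<^sub>R x) = locus x"
  by (simp add: locus_def lor_simps)

text \<open>Nullity reads \<open>n \<bullet> n = a * d\<close>. If \<open>a = 0\<close>, only the
  last coordinate survives; otherwise division by \<open>a\<close> lands on the paraboloid.\<close>

lemma null_vector_eq_pt:
  assumes "z \<noteq> 0" "lor z z = 0"
  obtains t P where "t \<noteq> 0" "z = t *\<^sub>R pt P"
proof -
  obtain n a d where z: "z = (n, a, d)" by (metis prod_cases3)
  have nn: "n \<bullet> n = a * d" using assms(2) by (simp add: z lor_def field_simps)
  show thesis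
  proof (cases "a = 0")
    case True
    then have "n = 0" using nn by simp
    then have "d \<noteq> 0" "z = d *\<^sub>R pt Infty"
      using assms(1) True z by (auto simp: zero_prod_def)
    then show thesis using that by blast
  next
    case False
    then have "z = a *\<^sub>R pt (Fin (n /\<^sub>R a))"
      by (simp add: z nn field_simps)
    then show thesis using that False by blast
  qed
qed

text \<open>Signature (3, 1) admits no totally null plane: orthogonal lifts belong to the same
  point.\<close>

lemma null_orthogonal_null:
  assumes "z \<noteq> 0" "lor z z = 0" "lor w w = 0" "lor w z = 0"
  obtains t where "w = t *\<^sub>R z"
proof (cases "w = 0")
  case True
  then show thesis using that[of 0] by simp
next
  case False
  obtain s P where s: "s \<noteq> 0" "z = s *\<^sub>R pt P" using null_vector_eq_pt assms by blast
  obtain t R where t: "t \<noteq> 0" "w = t *\<^sub>R pt R" using null_vector_eq_pt False assms by blast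
  have "R = P" using assms(4) s t by (simp add: lor_simps lor_pt_pt_eq_0_iff)
  then show thesis using that[of "t / s"] s t by simp
qed

section \<open>Vectors of circles and lines\<close>

lemma circle_represented:
  assumes "is_circle X" obtains x where "lor x x = 1" "X = locus x"
proof -
  obtain c r where r: "r > 0" "X = Fin ` sphere c r" using assms by (auto simp: is_circle_def)
  \<comment> \<open>The monic equation of the circle has square \<open>r\<^sup>2\<close>, so
    dividing it by \<open>r\<close> gives a unit vector.\<close>
  let ?x = "(c /\<^sub>R r, 1 / r, (c \<bullet> c - r\<^sup>2) / r) :: circle_vec"
  have 1: "lor ?x ?x = 1" using r(1) by (simp add: lor_def field_simps power2_eq_square)
  have "lor ?x (pt (Fin u)) = (r\<^sup>2 - (dist c u)\<^sup>2) / (2 * r)" for u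
    using r(1) by (simp add: lor_def dist_norm power2_norm_eq_inner inner_diff_left inner_diff_right inner_commute field_simps)
  then have "lor ?x (pt (Fin u)) = 0 \<longleftrightarrow> u \<in> sphere c r" for u
    using r(1) power2_eq_iff_nonneg[of "dist c u" r] by (auto simp del: power2_eq_iff_nonneg)
  moreover have "lor ?x (pt Infty) \<noteq> 0" using r(1) by (simp add: lor_def)
  ultimately have *: "Fin u \<in> locus ?x \<longleftrightarrow> u \<in> sphere c r" "Infty \<notin> locus ?x" for u
    by (simp_all only: locus_def mem_Collect_eq not_False_eq_True)
  have "P \<in> locus ?x \<longleftrightarrow> P \<in> X" for P
    unfolding r(2) by (cases P) (simp_all only: * image_iff, blast+)
  then show thesis using that[of ?x] 1 by blast
qed

text \<open>A line in the plane is a hyperplane. The unit normal form is returned along with the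
  vector because parallelism is read off from it.\<close>

lemma line_represented:
  assumes "is_line X"
  obtains n e where "n \<bullet> n = 1" "X = ext_line {u. n \<bullet> u = e}" "X = locus (n, 0, 2 * e)"
proof -
  obtain L where L: "affine L" "aff_dim L = 1" "X = ext_line L" using assms by (auto simp: is_line_def)
  have "aff_dim L = int (DIM(real^2)) - 1" using L by simp
  then obtain a b where ab: "a \<noteq> 0" "L = {u. a \<bullet> u = b}"
    using aff_dim_eq_hyperplane[of L] affine_hull_eq[of L] L(1) by (metis of_nat_diff DIM_positive Suc_leI One_nat_def of_nat_1)
  define n e where "n = a /\<^sub>R norm a" and "e = b / norm a"
  have nn: "n \<bullet> n = 1" using ab(1) by (simp add: n_def dot_square_norm power2_eq_square)
  have "a \<bullet> u = b \<longleftrightarrow> n \<bullet> u = e" for u using ab(1) by (simp add: n_def e_def field_simps)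
  then have X: "X = ext_line {u. n \<bullet> u = e}" using L(3) ab(2) by simp
  have "P \<in> X \<longleftrightarrow> P \<in> locus (n, 0, 2 * e)" for P
    unfolding X ext_line_def locus_def by (cases P) (auto simp: lor_def)
  then show thesis using that nn X by blast
qed

lemma represents_exists:
  assumes "gen_circle X" shows "\<exists>x. represents x X"
  using assms unfolding gen_circle_def
proof (elim disjE)
  assume "is_circle X" then show ?thesis using circle_represented unfolding represents_def by metis
next
  assume X: "is_line X"
  then obtain n e where *: "n \<bullet> n = 1" "X = locus (n, 0, 2 * e)" using line_represented by metis
  have "lor (n, 0, 2 * e) (n, 0, 2 * e) = 1" using *(1) by (simp add: lor_def)
  then show ?thesis using X * unfolding represents_def by metis
next
  assume "is_point X" then show ?thesis unfolding is_point_def represents_def using locus_pt by metis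
qed

lemma represents_nonzero: "represents x X \<Longrightarrow> x \<noteq> 0"
  unfolding represents_def using pt_nonzero by fastforce

section \<open>Nondegeneracy and second null lines\<close>

lemma exists_not_orthogonal: "p \<noteq> 0 \<Longrightarrow> \<exists>v. lor v p \<noteq> 0"
proof -
  assume "p \<noteq> 0"
  obtain n a d where p: "p = (n, a, d)" by (metis prod_cases3)
  \<comment> \<open>Swapping and negating the last two coordinates turns the form into a sum of
    squares.\<close>
  have "lor (n, -d, -a) p = n \<bullet> n + (a * a + d * d) / 2" by (simp add: lor_def p field_simps)
  moreover have "\<dots> \<noteq> 0"
    using \<open>p \<noteq> 0\<close> sum_squares_ge_zero[of a d]
    by (auto simp: p zero_prod_def add_nonneg_eq_0_iff)
  ultimately show ?thesis by metis
qed

text \<open>The span of \<open>w\<close> and \<open>pt P\<close> is a hyperbolic plane, so it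
  contains a second null line, which is again a point.\<close>

lemma second_point:
  assumes "lor w (pt P) \<noteq> 0"
  obtains R c d where "R \<noteq> P" "pt R = c *\<^sub>R w + d *\<^sub>R pt P"
proof -
  \<comment> \<open>The coefficient is the one that cancels \<open>lor w w\<close>.\<close>
  define q where "q = w - (lor w w / (2 * lor w (pt P))) *\<^sub>R pt P"
  have qq: "lor q q = 0" using assms by (simp add: q_def lor_simps lor_commute[of "pt P"] field_simps)
  have qp: "lor q (pt P) \<noteq> 0" using assms by (simp add: q_def lor_simps)
  then have "q \<noteq> 0" by auto
  then obtain t R where R: "t \<noteq> 0" "q = t *\<^sub>R pt R" using null_vector_eq_pt qq by blast
  have "R \<noteq> P" using qp R by (auto simp: lor_simps)
  moreover have "pt R = (1/t) *\<^sub>R q" using R by simp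
  then have "pt R = (1/t) *\<^sub>R w + (- (1/t) * (lor w w / (2 * lor w (pt P)))) *\<^sub>R pt P"
    unfolding q_def by (simp add: algebra_simps)
  ultimately show thesis using that by blast
qed

text \<open>The orthogonal complement of a unit vector is nondegenerate. A null line in it therefore
  lies in a hyperbolic plane inside it, which supplies a second point.\<close>

lemma locus_unit_not_singleton:
  assumes "lor x x = 1" shows "locus x \<noteq> {P}"
proof
  assume *: "locus x = {P}"
  then have xP: "lor x (pt P) = 0" by (auto simp: locus_def)
  obtain v where v: "lor v (pt P) \<noteq> 0" using exists_not_orthogonal[OF pt_nonzero] by blast
  \<comment> \<open>Projection of \<open>v\<close> along \<open>x\<close>; the product with
    \<open>pt P\<close> is unchanged, as \<open>x\<close> is orthogonal to
    \<open>pt P\<close>.\<close>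
  define w where "w = v - lor v x *\<^sub>R x"
  have "lor w (pt P) \<noteq> 0" using v xP by (simp add: w_def lor_simps)
  then obtain R c d where R: "R \<noteq> P" "pt R = c *\<^sub>R w + d *\<^sub>R pt P" using second_point by blast
  have "lor x w = 0" using assms by (simp add: w_def lor_simps lor_commute[of v])
  then have "R \<in> locus x" using R xP by (simp add: locus_def lor_simps)
  then show False using * R by blast
qed

text \<open>If the span of \<open>x\<close> and \<open>y\<close> is nondegenerate, then so is its orthogonal complement, so the
  latter contains no null line or exactly two of them.\<close>

lemma lor_sq_if_singleton_Int:
  assumes x: "lor x x = 1" and y: "lor y y = 1" and "locus x \<inter> locus y = {P}"
  shows "(lor x y)\<^sup>2 = 1"
proof (rule ccontr)
  define g where "g = lor x y"
  assume "(lor x y)\<^sup>2 \<noteq> 1"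
  then have g: "1 - g * g \<noteq> 0" by (simp add: g_def power2_eq_square)
  have P: "lor x (pt P) = 0" "lor y (pt P) = 0" using assms(3) by (auto simp: locus_def)
  obtain v where v: "lor v (pt P) \<noteq> 0" using exists_not_orthogonal[OF pt_nonzero] by blast
  \<comment> \<open>\<open>a\<close> and \<open>b\<close> solve the Gram system of \<open>x\<close>
    and \<open>y\<close>, whose determinant is \<open>1 - g * g\<close>; subtracting them from
    \<open>v\<close> projects onto the complement of both vectors.\<close>
  define a where "a = (lor v x - g * lor v y) / (1 - g * g)"
  define b where "b = (lor v y - g * lor v x) / (1 - g * g)"
  have ab: "a + g * b = lor v x" "g * a + b = lor v y"
    using g unfolding a_def b_def by (simp_all add: divide_simps) (simp_all add: algebra_simps)
  define w where "w = v - a *\<^sub>R x - b *\<^sub>R y"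
  have w: "lor x w = 0" "lor y w = 0"
    using ab x y by (simp_all add: w_def lor_simps lor_commute[of _ v] lor_commute[of y x] g_def[symmetric] algebra_simps)
  have "lor w (pt P) \<noteq> 0" using v P by (simp add: w_def lor_simps)
  then obtain R c d where R: "R \<noteq> P" "pt R = c *\<^sub>R w + d *\<^sub>R pt P" using second_point by blast
  have "R \<in> locus x \<inter> locus y" using R w P by (simp add: locus_def lor_simps)
  then show False using assms(3) R by blast
qed

text \<open>A curve is the locus of some unit vector, hence not a singleton; this rules out the
  alternative \<open>x = pt P\<close>.\<close>

lemma represents_unit:
  assumes "represents x X" "is_circle X \<or> is_line X" shows "lor x x = 1"
proof -
  obtain x' where x': "lor x' x' = 1" "X = locus x'"
    using assms(2)
  proof
    assume "is_line X"
    then obtain n e where *: "n \<bullet> n = 1" "X = locus (n, 0, 2 * e)" using line_represented by metis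
    then show thesis using that[of "(n, 0, 2 * e)"] by (simp add: lor_def)
  qed (use that circle_represented in metis)
  show ?thesis using assms(1) x' locus_unit_not_singleton locus_pt unfolding represents_def by metis
qed

lemma represents_norm: "represents x X \<Longrightarrow> lor x x = 0 \<or> lor x x = 1"
  by (auto simp: represents_def)

lemma represents_null:
  assumes "represents x X" "lor x x = 0" obtains P where "x = pt P" "X = {P}"
  using assms locus_pt by (auto simp: represents_def)

lemma represents_singleton: "represents x {P} \<Longrightarrow> x = pt P"
  unfolding represents_def
  by (metis locus_pt locus_unit_not_singleton singleton_inject)

section \<open>Tangency in terms of the form\<close>

lemma distinct_lines_Int:
  assumes "parallel_lines X Y" shows "X \<inter> Y = {Infty}"
proof -
  obtain L M where LM: "is_line X" "X \<noteq> Y" "X = ext_line L" "Y = ext_line M" "affine_parallel L M"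
    using assms by (auto simp: parallel_lines_def)
  obtain a where a: "M = (\<lambda>x. a + x) ` L" using LM(5) by (auto simp: affine_parallel_def)
  obtain n e where "X = ext_line {u. n \<bullet> u = e}" using line_represented[OF LM(1)] by metis
  then have "Fin ` L = Fin ` {u. n \<bullet> u = e}" using LM(3) unfolding ext_line_def by blast
  then have L: "L = {u. n \<bullet> u = e}" by (metis ext_plane.inject inj_def inj_image_eq_iff)
  \<comment> \<open>A translate keeps the normal and shifts the constant by
    \<open>n \<bullet> a\<close>, so distinct parallels share no finite point.\<close>
  have M: "u \<in> M \<longleftrightarrow> n \<bullet> u = e + n \<bullet> a" for u
  proof -
    have "u \<in> M \<longleftrightarrow> u - a \<in> L" unfolding a by (auto simp: image_iff intro!: bexI[of _ "u - a"])
    then show ?thesis by (auto simp: L inner_diff_right)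
  qed
  have "n \<bullet> a \<noteq> 0"
  proof
    assume "n \<bullet> a = 0"
    then have "M = L" using L M by auto
    then show False using LM(2-4) by simp
  qed
  then have "L \<inter> M = {}" using L M by auto
  then show ?thesis using LM by (auto simp: ext_line_def)
qed

text \<open>Two tangent curves have exactly one common point, parallel lines included, which forces
  product 1 or -1. For a point on a curve both sides are 0. The second claim records that two points
  are never tangent.\<close>

lemma tangent_lor:
  assumes "tangent X Y" "represents x X" "represents y Y"
  shows "(lor x y)\<^sup>2 = lor x x * lor y y" "lor x x = 1 \<or> lor y y = 1"
proof -
  have locus: "X = locus x" "Y = locus y" using assms by (auto simp: represents_def)
  obtain P where "tangent_at P X Y" using assms by (auto simp: tangent_def)
  then have "(is_circle X \<or> is_line X) \<and> (is_circle Y \<or> is_line Y) \<and> X \<inter> Y = {P}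
    \<or> X = {P} \<and> (is_circle Y \<or> is_line Y) \<and> P \<in> Y \<or> Y = {P} \<and> (is_circle X \<or> is_line X) \<and> P \<in> X"
    unfolding tangent_at_def
  proof (elim disjE conjE)
    assume "parallel_lines X Y" "P = Infty"
    then show ?thesis using distinct_lines_Int by (simp add: parallel_lines_def)
  qed (auto simp: circle_tangent_at_def point_tangent_at_def Int_commute)
  then consider (curves) "is_circle X \<or> is_line X" "is_circle Y \<or> is_line Y" "X \<inter> Y = {P}"
    | (left) "X = {P}" "is_circle Y \<or> is_line Y" "P \<in> Y"
    | (right) "Y = {P}" "is_circle X \<or> is_line X" "P \<in> X" by argo
  then have "(lor x y)\<^sup>2 = lor x x * lor y y \<and> (lor x x = 1 \<or> lor y y = 1)"
  proof cases
    case curves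
    then have "lor x x = 1" "lor y y = 1" using represents_unit assms(2,3) by blast+
    then show ?thesis using lor_sq_if_singleton_Int curves(3) locus by simp
  next
    case left
    then have "x = pt P" using represents_singleton assms by blast
    then show ?thesis using left represents_unit assms(3) locus by (auto simp: locus_def lor_commute)
  next
    case right
    then have "y = pt P" using represents_singleton assms by blast
    then show ?thesis using right represents_unit assms(2) locus by (auto simp: locus_def lor_commute)
  qed
  then show "(lor x y)\<^sup>2 = lor x x * lor y y" "lor x x = 1 \<or> lor y y = 1" by auto
qed

text \<open>A converse at a known point: a common point of two members of the pencil is orthogonal
  to a nonzero multiple of \<open>pt P\<close>, hence equals \<open>P\<close>. Only two lines need
  more, since their tangency is defined by parallelism.\<close>

lemma tangent_at_if_pencil:
  assumes x: "represents x X" "lor x (pt P) = 0" and y: "represents y Y" "lor y (pt P) = 0"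
    and "X \<noteq> Y"
    and pencil: "lor x x = 1 \<Longrightarrow> lor y y = 1 \<Longrightarrow> \<exists>s t. s \<noteq> 0 \<and> y = s *\<^sub>R x + t *\<^sub>R pt P"
  shows "tangent_at P X Y"
proof -
  have locus: "X = locus x" "Y = locus y" using x y by (auto simp: represents_def)
  have P: "P \<in> X" "P \<in> Y" using x(2) y(2) locus by (auto simp: locus_def)
  have singleton: "Z = {P}" if "represents z Z" "lor z z \<noteq> 1" "P \<in> Z" for z Z
    using that represents_norm represents_null by blast
  have curve: "is_circle Z \<or> is_line Z" if "represents z Z" "lor z z = 1" for z Z
    using that lor_pt_self unfolding represents_def by fastforce
  consider "lor x x \<noteq> 1" | "lor y y \<noteq> 1" | "lor x x = 1" "lor y y = 1" by blast
  then show ?thesis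
  proof cases
    case 1
    then have "X = {P}" using singleton x(1) P by blast
    moreover have "lor y y = 1" using singleton[OF y(1)] P \<open>X \<noteq> Y\<close> calculation by blast
    ultimately show ?thesis using curve y(1) P by (simp add: tangent_at_def point_tangent_at_def)
  next
    case 2
    then have "Y = {P}" using singleton y(1) P by blast
    moreover have "lor x x = 1" using singleton[OF x(1)] P \<open>X \<noteq> Y\<close> calculation by blast
    ultimately show ?thesis using curve x(1) P by (simp add: tangent_at_def point_tangent_at_def)
  next
    case 3
    then obtain s t where st: "s \<noteq> 0" "y = s *\<^sub>R x + t *\<^sub>R pt P" using pencil by blast
    have "t \<noteq> 0"
    proof
      assume "t = 0"
      then have "locus y = locus x" using st locus_scale by simp
      then show False using locus \<open>X \<noteq> Y\<close> by simp
    qed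
    have "R = P" if "R \<in> X" "R \<in> Y" for R
      using that st \<open>t \<noteq> 0\<close> by (simp add: locus locus_def lor_simps lor_pt_pt_eq_0_iff)
    then have XY: "X \<inter> Y = {P}" using P by blast
    show ?thesis
    proof (cases "is_circle X \<or> is_circle Y")
      case True
      then show ?thesis using XY curve[OF x(1)] curve[OF y(1)] 3
        by (auto simp: tangent_at_def circle_tangent_at_def Int_commute)
    next
      case False
      then have lines: "is_line X" "is_line Y" using 3 curve x(1) y(1) by blast+
      then have "Infty \<in> X \<inter> Y" by (auto simp: is_line_def ext_line_def)
      then have PI: "P = Infty" using XY by auto
      obtain n a d where nad: "x = (n, a, d)" by (metis prod_cases3)
      have "a = 0" using x(2) by (simp add: PI nad lor_def)
      then have nn: "n \<bullet> n = 1" using 3(1) by (simp add: nad lor_def)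
      \<comment> \<open>Adding a multiple of \<open>pt Infty\<close> changes only the constant term,
        so both lines have normal \<open>n\<close>; these are the resulting constants.\<close>
      define e e' where "e = d / 2" and "e' = (s * d + t) / (2 * s)"
      have y_eq: "y = (s *\<^sub>R n, 0, s * d + t)" using st(2) by (simp add: nad PI \<open>a = 0\<close>)
      have X: "X = ext_line {u. n \<bullet> u = e}"
      proof (rule set_eqI)
        fix R show "R \<in> X \<longleftrightarrow> R \<in> ext_line {u. n \<bullet> u = e}"
          by (cases R) (auto simp: locus locus_def ext_line_def nad \<open>a = 0\<close> lor_def e_def)
      qed
      have Y: "Y = ext_line {u. n \<bullet> u = e'}"
      proof (rule set_eqI)
        fix R show "R \<in> Y \<longleftrightarrow> R \<in> ext_line {u. n \<bullet> u = e'}"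
          using st(1) by (cases R) (auto simp: locus locus_def ext_line_def y_eq lor_def e'_def field_simps)
      qed
      have "{u. n \<bullet> u = e'} = (\<lambda>u. (e' - e) *\<^sub>R n + u) ` {u. n \<bullet> u = e}"
      proof (rule set_eqI)
        fix u show "u \<in> {u. n \<bullet> u = e'} \<longleftrightarrow> u \<in> (\<lambda>u. (e' - e) *\<^sub>R n + u) ` {u. n \<bullet> u = e}"
          using nn by (auto simp: image_iff inner_diff_right inner_add_right
              intro!: exI[of _ "u - (e' - e) *\<^sub>R n"])
      qed
      then have "affine_parallel {u. n \<bullet> u = e} {u. n \<bullet> u = e'}" unfolding affine_parallel_def by blast
      then have "parallel_lines X Y" unfolding parallel_lines_def using lines \<open>X \<noteq> Y\<close> X Y by blast
      then show ?thesis using PI by (simp add: tangent_at_def)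
    qed
  qed
qed

text \<open>The form is positive semidefinite on the orthogonal complement of the null vector \<open>z\<close>, with
  radical spanned by \<open>z\<close>; hence unit vectors there with product \<open>\<plusminus>1\<close> agree up to sign modulo \<open>z\<close>.\<close>

lemma all_tangent_if_null_orthogonal:
  assumes z: "z \<noteq> 0" "lor z z = 0" and y: "lor y y = 1" "lor y z = 0"
    and f: "\<And>X. X \<in> S \<Longrightarrow> represents (f X) X" "\<And>X. X \<in> S \<Longrightarrow> lor (f X) z = 0"
      "\<And>X. X \<in> S \<Longrightarrow> (lor y (f X))\<^sup>2 = lor (f X) (f X)"
  shows "all_tangent_at_one_point S"
proof -
  obtain k P where kP: "k \<noteq> 0" "z = k *\<^sub>R pt P" using null_vector_eq_pt z by blast
  have *: "\<exists>s t. s \<noteq> 0 \<and> s * s = 1 \<and> f X = s *\<^sub>R y + t *\<^sub>R pt P"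
    if X: "X \<in> S" "lor (f X) (f X) = 1" for X
  proof -
    define s where "s = lor y (f X)"
    have s: "s * s = 1" using f(3)[OF X(1)] X(2) by (simp add: s_def power2_eq_square)
    \<comment> \<open>As \<open>s\<close> is a sign, this difference is null; being orthogonal to
      \<open>z\<close> as well, it is a multiple of \<open>z\<close>.\<close>
    have "lor (f X - s *\<^sub>R y) (f X - s *\<^sub>R y) = 1 - s * s"
      using X(2) y by (simp add: lor_simps lor_commute[of "f X" y] s_def[symmetric] algebra_simps)
    moreover have "lor (f X - s *\<^sub>R y) z = 0" using f(2)[OF X(1)] y by (simp add: lor_simps)
    ultimately obtain t where "f X - s *\<^sub>R y = t *\<^sub>R z"
      using null_orthogonal_null[OF z, of "f X - s *\<^sub>R y"] s by auto
    then have "f X = s *\<^sub>R y + (t * k) *\<^sub>R pt P" by (simp add: kP algebra_simps)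
    moreover have "s \<noteq> 0" using s by auto
    ultimately show ?thesis using s by blast
  qed
  have "tangent_at P X Y" if XY: "X \<in> S" "Y \<in> S" "X \<noteq> Y" for X Y
  proof (rule tangent_at_if_pencil[of "f X" _ _ "f Y"])
    show "lor (f X) (pt P) = 0" "lor (f Y) (pt P) = 0"
      using f(2) XY kP by (force simp: lor_simps)+
    assume u: "lor (f X) (f X) = 1" "lor (f Y) (f Y) = 1"
    obtain s t where s: "s * s = 1" "f X = s *\<^sub>R y + t *\<^sub>R pt P" using * XY u by blast
    obtain s' t' where s': "s' \<noteq> 0" "f Y = s' *\<^sub>R y + t' *\<^sub>R pt P" using * XY u by blast
    \<comment> \<open>Elimination of \<open>y\<close>, where \<open>s\<close> is its own
      inverse.\<close>
    have "f Y = (s' * s) *\<^sub>R f X + (t' - s' * s * t) *\<^sub>R pt P"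
      using s(1) by (simp add: s s' algebra_simps)
    moreover have "s' * s \<noteq> 0" using s s' by auto
    ultimately show "\<exists>s t. s \<noteq> 0 \<and> f Y = s *\<^sub>R f X + t *\<^sub>R pt P" by blast
  qed (use f XY in auto)
  then show ?thesis unfolding all_tangent_at_one_point_def pairwise_def by blast
qed

section \<open>Linear dependence\<close>

text \<open>The Gram matrix of \<open>lor\<close> with respect to the Euclidean inner product; it
  carries dimension formulas for Euclidean orthogonality over to \<open>lor\<close>.\<close>

definition lor_dual :: "circle_vec \<Rightarrow> circle_vec" where
  "lor_dual x = (fst x, - snd (snd x) / 2, - fst (snd x) / 2)"

lemma lor_eq_inner: "lor x y = lor_dual x \<bullet> y"
  by (simp add: lor_def lor_dual_def inner_prod_def field_simps)

lemma linear_lor_dual: "linear lor_dual"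
  by (rule linearI) (simp_all add: lor_dual_def field_simps)

lemma lor_dual_eq_0_iff: "lor_dual x = 0 \<longleftrightarrow> x = 0"
  by (auto simp: lor_dual_def prod_eq_iff)

text \<open>The complement of a nonzero vector has dimension 3, too small for four independent
  vectors.\<close>

lemma four_orthogonal_dependent:
  assumes "w \<noteq> 0" "lor w x1 = 0" "lor w x2 = 0" "lor w x3 = 0" "lor w x4 = 0"
    and "distinct [x1, x2, x3, x4]"
  obtains c1 c2 c3 c4 where "c1 *\<^sub>R x1 + c2 *\<^sub>R x2 + c3 *\<^sub>R x3 + c4 *\<^sub>R x4 = 0"
    "\<not> (c1 = 0 \<and> c2 = 0 \<and> c3 = 0 \<and> c4 = 0)"
proof -
  let ?B = "{x1, x2, x3, x4}" and ?V = "{v. lor_dual w \<bullet> v = 0}"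
  have "lor_dual w \<noteq> 0" using assms(1) by (simp add: lor_dual_eq_0_iff)
  then have "dim ?V = 3" by (simp add: dim_hyperplane)
  moreover have "?B \<subseteq> ?V" using assms by (simp add: lor_eq_inner)
  moreover have "card ?B = 4" using assms(6) by simp
  ultimately have "dependent ?B" using independent_card_le_dim[of ?B ?V] by fastforce
  then obtain u where u: "\<exists>v\<in>?B. u v \<noteq> 0" "(\<Sum>v\<in>?B. u v *\<^sub>R v) = 0"
    using dependent_finite[of ?B] by blast
  have "(\<Sum>v\<in>?B. u v *\<^sub>R v) = u x1 *\<^sub>R x1 + u x2 *\<^sub>R x2 + u x3 *\<^sub>R x3 + u x4 *\<^sub>R x4"
    using assms(6) by (simp add: add.assoc)
  then show thesis using that[of "u x1" "u x2" "u x3" "u x4"] u by auto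
qed

text \<open>\<open>lor_dual\<close> is injective, so the complement has dimension 4 - 3 = 1, and
  \<open>z\<close> spans it.\<close>

lemma orthogonal_three_independent:
  assumes ind: "\<And>\<alpha> \<beta> \<gamma>. \<alpha> *\<^sub>R a + \<beta> *\<^sub>R b + \<gamma> *\<^sub>R c = 0 \<Longrightarrow> \<alpha> = 0 \<and> \<beta> = 0 \<and> \<gamma> = 0"
  obtains z where "\<And>v. lor a v = 0 \<Longrightarrow> lor b v = 0 \<Longrightarrow> lor c v = 0 \<Longrightarrow> \<exists>t. v = t *\<^sub>R z"
proof -
  let ?B = "{a, b, c}"
  have dist: "distinct [a, b, c]"
    using ind[of 1 "-1" 0] ind[of 1 0 "-1"] ind[of 0 1 "-1"] by auto
  have "independent ?B"
  proof
    assume "dependent ?B"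
    then obtain u where u: "\<exists>v\<in>?B. u v \<noteq> 0" "(\<Sum>v\<in>?B. u v *\<^sub>R v) = 0"
      using dependent_finite[of ?B] by blast
    have "(\<Sum>v\<in>?B. u v *\<^sub>R v) = u a *\<^sub>R a + u b *\<^sub>R b + u c *\<^sub>R c"
      using dist by (simp add: add.assoc)
    then show False using u ind by auto
  qed
  moreover have "card ?B = 3" using dist by simp
  ultimately have "dim (span ?B) = 3" by (simp add: dim_eq_card_independent)
  moreover have "inj_on lor_dual (span ?B)"
    by (metis injD inj_on_def linear_injective_0 linear_lor_dual lor_dual_eq_0_iff)
  ultimately have d3: "dim (lor_dual ` span ?B) = 3"
    using dim_image_eq[OF linear_lor_dual, of "span ?B"] by (simp add: span_span)
  let ?V = "{v \<in> UNIV. \<forall>x\<in>lor_dual ` span ?B. orthogonal x v}"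
  have "dim ?V + dim (lor_dual ` span ?B) = DIM(circle_vec)"
    using dim_subspace_orthogonal_to_vectors[of "lor_dual ` span ?B" UNIV] linear_lor_dual
    by (simp add: linear_subspace_image dim_UNIV)
  then have "dim ?V = 1" using d3 by simp
  moreover obtain C where "C \<subseteq> ?V" "independent C" and C: "?V \<subseteq> span C" "card C = dim ?V"
    by (rule basis_exists)
  ultimately obtain z where "C = {z}" using card_1_singletonE by metis
  then have V: "v \<in> ?V \<Longrightarrow> \<exists>t. v = t *\<^sub>R z" for v using C by (auto simp: span_singleton)
  have "v \<in> ?V" if "lor a v = 0" "lor b v = 0" "lor c v = 0" for v
  proof -
    have "lor x v = 0" if "x \<in> span ?B" for x
      using that
      by (induction rule: span_induct_alt) (use \<open>lor a v = 0\<close> \<open>lor b v = 0\<close> \<open>lor c v = 0\<close> in \<open>auto simp: lor_simps\<close>)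
    then show ?thesis by (simp add: orthogonal_def lor_eq_inner)
  qed
  then show thesis using that V by blast
qed

text \<open>The lifts of three distinct points are independent, because their Gram matrix has zero
  diagonal and nonzero entries elsewhere. Both vectors then lie in the same one-dimensional
  complement.\<close>

lemma locus_eq_if_three_points:
  assumes "lor x x = 1" "lor y y = 1" and "P \<noteq> Q" "P \<noteq> R" "Q \<noteq> R"
    and "{P, Q, R} \<subseteq> locus x" "{P, Q, R} \<subseteq> locus y"
  shows "locus x = locus y"
proof -
  let ?p = "lor (pt P) (pt Q)" and ?q = "lor (pt P) (pt R)" and ?r = "lor (pt Q) (pt R)"
  have nz: "?p \<noteq> 0" "?q \<noteq> 0" "?r \<noteq> 0" using assms by (simp_all add: lor_pt_pt_eq_0_iff)
  have "\<alpha> = 0 \<and> \<beta> = 0 \<and> \<gamma> = 0"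
    if "\<alpha> *\<^sub>R pt P + \<beta> *\<^sub>R pt Q + \<gamma> *\<^sub>R pt R = 0" for \<alpha> \<beta> \<gamma>
  proof -
    from that have "lor (\<alpha> *\<^sub>R pt P + \<beta> *\<^sub>R pt Q + \<gamma> *\<^sub>R pt R) (pt S) = 0" for S by simp
    from this[of P] this[of Q] this[of R]
    have e: "\<beta> * ?p + \<gamma> * ?q = 0" "\<alpha> * ?p + \<gamma> * ?r = 0" "\<alpha> * ?q + \<beta> * ?r = 0"
      by (simp_all add: lor_simps lor_commute[of "pt Q" "pt P"] lor_commute[of "pt R" "pt P"] lor_commute[of "pt R" "pt Q"])
    \<comment> \<open>The combination of the three equations in which \<alpha> and \<beta>
      cancel.\<close>
    have "2 * \<gamma> * (?q * ?r) = (\<beta> * ?p + \<gamma> * ?q) * ?r + (\<alpha> * ?p + \<gamma> * ?r) * ?q - ?p * (\<alpha> * ?q + \<beta> * ?r)"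
      by (simp add: algebra_simps)
    then have "\<gamma> = 0" using e nz by simp
    then show ?thesis using e nz by simp
  qed
  then obtain z where z: "\<And>v. lor (pt P) v = 0 \<Longrightarrow> lor (pt Q) v = 0 \<Longrightarrow> lor (pt R) v = 0 \<Longrightarrow> \<exists>t. v = t *\<^sub>R z"
    using orthogonal_three_independent by blast
  obtain s where s: "x = s *\<^sub>R z" using z[of x] assms(6) by (auto simp: locus_def lor_commute)
  obtain t where t: "y = t *\<^sub>R z" using z[of y] assms(7) by (auto simp: locus_def lor_commute)
  have "s \<noteq> 0" "t \<noteq> 0" using s t assms(1,2) by auto
  then show ?thesis using s t locus_scale by simp
qed

text \<open>Used contrapositively: a nontrivial relation among vectors of distinct circles cannot
  involve only two of them.\<close>

lemma locus_proportional:
  assumes "a *\<^sub>R x + b *\<^sub>R y = 0" "\<not> (a = 0 \<and> b = 0)" "x \<noteq> 0" "y \<noteq> 0"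
  shows "locus x = locus y"
proof -
  have "a \<noteq> 0" "b \<noteq> 0" using assms by auto
  moreover have "x = (- b / a) *\<^sub>R y"
  proof -
    have "a *\<^sub>R x = - b *\<^sub>R y" using assms(1) by (simp add: eq_neg_iff_add_eq_0)
    then have "(1 / a) *\<^sub>R a *\<^sub>R x = (1 / a) *\<^sub>R (- b *\<^sub>R y)" by simp
    then show ?thesis using \<open>a \<noteq> 0\<close> by simp
  qed
  ultimately show ?thesis by (metis divide_eq_0_iff locus_scale neg_equal_0_iff_equal)
qed

section \<open>Sign patterns\<close>

lemma four_squares_eq_0:
  fixes a b c d :: real
  assumes "a * a + b * b + c * c + d * d = 0" shows "a = 0 \<and> b = 0 \<and> c = 0 \<and> d = 0"
proof -
  have "a * a = 0" "b * b = 0" "c * c = 0" "d * d = 0"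
    using assms zero_le_square[of a] zero_le_square[of b] zero_le_square[of c] zero_le_square[of d] by linarith+
  then show ?thesis by simp
qed

text \<open>For a unit vector \<open>y = \<Sum>i. s i *\<^sub>R e i\<close> in the dual basis, \<open>lor y y\<close> is a quadratic polynomial in
  the signs \<open>s i\<close>, so it has no component along the character \<open>s 1 * s 2 * s 3 * s 4\<close>. If \<open>lor y y = 1\<close>
  held for all but one of the sign patterns, it would hold for all, the dual basis would be
  orthonormal, and the form positive definite.\<close>

lemma not_seven_patterns:
  assumes unit: "lor x1 x1 = 1" "lor x2 x2 = 1" "lor x3 x3 = 1" "lor x4 x4 = 1"
    and nondeg: "\<And>w. lor w x1 = 0 \<Longrightarrow> lor w x2 = 0 \<Longrightarrow> lor w x3 = 0 \<Longrightarrow> lor w x4 = 0 \<Longrightarrow> w = 0"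
    and sol: "\<And>s2 s3 s4 :: real. {s2, s3, s4} \<subseteq> {-1, 1} \<Longrightarrow> (s2, s3, s4) \<noteq> (-1, -1, -1) \<Longrightarrow>
      \<exists>y. lor y y = 1 \<and> lor y x1 = 1 \<and> lor y x2 = s2 \<and> lor y x3 = s3 \<and> lor y x4 = s4"
  shows False
proof -
  have eqI: "v = w" if "lor v x1 = lor w x1" "lor v x2 = lor w x2" "lor v x3 = lor w x3" "lor v x4 = lor w x4" for v w
    using nondeg[of "v - w"] that by (simp add: lor_simps)
  obtain a where a: "lor a a = 1" "lor a x1 = 1" "lor a x2 = 1" "lor a x3 = 1" "lor a x4 = 1"
    using sol[of 1 1 1] by auto
  obtain b2 where b2: "lor b2 b2 = 1" "lor b2 x1 = 1" "lor b2 x2 = -1" "lor b2 x3 = 1" "lor b2 x4 = 1"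
    using sol[of "-1" 1 1] by auto
  obtain b3 where b3: "lor b3 b3 = 1" "lor b3 x1 = 1" "lor b3 x2 = 1" "lor b3 x3 = -1" "lor b3 x4 = 1"
    using sol[of 1 "-1" 1] by auto
  obtain b4 where b4: "lor b4 b4 = 1" "lor b4 x1 = 1" "lor b4 x2 = 1" "lor b4 x3 = 1" "lor b4 x4 = -1"
    using sol[of 1 1 "-1"] by auto
  obtain b23 where b23: "lor b23 b23 = 1" "lor b23 x1 = 1" "lor b23 x2 = -1" "lor b23 x3 = -1" "lor b23 x4 = 1"
    using sol[of "-1" "-1" 1] by auto
  obtain b24 where b24: "lor b24 b24 = 1" "lor b24 x1 = 1" "lor b24 x2 = -1" "lor b24 x3 = 1" "lor b24 x4 = -1"
    using sol[of "-1" 1 "-1"] by auto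
  obtain b34 where b34: "lor b34 b34 = 1" "lor b34 x1 = 1" "lor b34 x2 = 1" "lor b34 x3 = -1" "lor b34 x4 = -1"
    using sol[of 1 "-1" "-1"] by auto
  \<comment> \<open>Half the difference of two solutions that differ in one sign is a dual basis
    vector.\<close>
  define e2 e3 e4 where "e2 = (1/2) *\<^sub>R (a - b2)" and "e3 = (1/2) *\<^sub>R (a - b3)" and "e4 = (1/2) *\<^sub>R (a - b4)"
  have e2: "lor e2 x1 = 0" "lor e2 x2 = 1" "lor e2 x3 = 0" "lor e2 x4 = 0"
    and e3: "lor e3 x1 = 0" "lor e3 x2 = 0" "lor e3 x3 = 1" "lor e3 x4 = 0"
    and e4: "lor e4 x1 = 0" "lor e4 x2 = 0" "lor e4 x3 = 0" "lor e4 x4 = 1"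
    by (simp_all add: e2_def e3_def e4_def lor_simps a b2 b3 b4)
  \<comment> \<open>Reversing one sign subtracts \<open>2 *\<^sub>R e\<close>; if the vector stays
    unit, the linear and quadratic terms cancel.\<close>
  have flip: "lor a e = lor e e" if "b = a - 2 *\<^sub>R e" "lor b b = 1" for b e
    using that(2) a(1) by (simp add: that(1) lor_simps lor_commute[of e a])
  have ae: "lor a e2 = lor e2 e2" "lor a e3 = lor e3 e3" "lor a e4 = lor e4 e4"
    using b2(1) b3(1) b4(1) by (auto intro!: flip simp: e2_def e3_def e4_def algebra_simps)
  \<comment> \<open>After two reversals only the mixed term remains, so it vanishes.\<close>
  have flip2: "lor e f = 0"
    if "b = a - 2 *\<^sub>R e - 2 *\<^sub>R f" "lor b b = 1" "lor a e = lor e e" "lor a f = lor f f" for b e f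
  proof -
    have "lor b b = lor a a - 4 * lor a e - 4 * lor a f + 4 * lor e e + 4 * lor f f + 8 * lor e f"
      by (simp add: that(1) lor_simps lor_commute[of e a] lor_commute[of f a] lor_commute[of f e] algebra_simps)
    then show ?thesis using that a(1) by simp
  qed
  have "b23 = a - 2 *\<^sub>R e2 - 2 *\<^sub>R e3" "b24 = a - 2 *\<^sub>R e2 - 2 *\<^sub>R e4" "b34 = a - 2 *\<^sub>R e3 - 2 *\<^sub>R e4"
    by (rule eqI; simp add: lor_simps a b23 b24 b34 e2 e3 e4)+
  then have ee: "lor e2 e3 = 0" "lor e2 e4 = 0" "lor e3 e4 = 0"
    using flip2 ae b23(1) b24(1) b34(1) by blast+
  \<comment> \<open>All four products of \<open>a\<close> are 1, so \<open>a\<close> is the sum of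
    the dual basis; this is the missing member.\<close>
  define e1 where "e1 = a - e2 - e3 - e4"
  have e1: "lor e1 x1 = 1" "lor e1 x2 = 0" "lor e1 x3 = 0" "lor e1 x4 = 0"
    by (simp_all add: e1_def lor_simps a e2 e3 e4)
  have e1e: "lor e1 e2 = 0" "lor e1 e3 = 0" "lor e1 e4 = 0"
    by (simp_all add: e1_def lor_simps ae ee lor_commute[of e3 e2] lor_commute[of e4 e2] lor_commute[of e4 e3])
  have expand: "w = lor w x1 *\<^sub>R e1 + lor w x2 *\<^sub>R e2 + lor w x3 *\<^sub>R e3 + lor w x4 *\<^sub>R e4" for w
    by (rule eqI) (simp_all add: lor_simps e1 e2 e3 e4)
  have coord: "lor w e1 = lor w x1 * lor e1 e1" "lor w e2 = lor w x2 * lor e2 e2"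
    "lor w e3 = lor w x3 * lor e3 e3" "lor w e4 = lor w x4 * lor e4 e4" for w
    by (subst expand[of w], simp add: lor_simps ee e1e lor_commute[of e2 e1] lor_commute[of e3 e1]
        lor_commute[of e4 e1] lor_commute[of e3 e2] lor_commute[of e4 e2] lor_commute[of e4 e3])+
  \<comment> \<open>Pairing each dual vector with its partner gives 1 on one side and, since the
    partner is unit, the square of the dual vector on the other.\<close>
  have "lor e1 e1 = 1" "lor e2 e2 = 1" "lor e3 e3 = 1" "lor e4 e4 = 1"
    using coord(1)[of x1] coord(2)[of x2] coord(3)[of x3] coord(4)[of x4] unit e1 e2 e3 e4
    by (simp_all add: lor_commute[of x1 e1] lor_commute[of x2 e2] lor_commute[of x3 e3] lor_commute[of x4 e4])
  then have "lor w w = lor w x1 * lor w x1 + lor w x2 * lor w x2 + lor w x3 * lor w x3 + lor w x4 * lor w x4" for w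
    by (subst (2) expand[of w], simp add: lor_simps coord[of w])
  \<comment> \<open>A null vector would have four zero coordinates, against nondegeneracy.\<close>
  from this[of "pt Infty", unfolded lor_pt_self, symmetric]
  have "lor (pt Infty) x1 = 0 \<and> lor (pt Infty) x2 = 0 \<and> lor (pt Infty) x3 = 0 \<and> lor (pt Infty) x4 = 0"
    by (rule four_squares_eq_0)
  then show False using nondeg[of "pt Infty"] pt_nonzero by blast
qed

text \<open>The possible triples of products with \<open>x2\<close>, \<open>x3\<close>,
  \<open>x4\<close>, whose squares are the \<open>q\<close>s: a curve allows both signs, a point
  only 0.\<close>

definition patterns :: "real \<Rightarrow> real \<Rightarrow> real \<Rightarrow> (real \<times> real \<times> real) set" where
  "patterns q2 q3 q4 = {s. s\<^sup>2 = q2} \<times> {s. s\<^sup>2 = q3} \<times> {s. s\<^sup>2 = q4}"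

lemma square_roots: "q = 0 \<or> q = 1 \<Longrightarrow> {s::real. s\<^sup>2 = q} = (if q = 0 then {0} else {-1, 1})"
  by (auto simp: power2_eq_1_iff)

lemma patterns_card:
  assumes "q2 \<in> {0, 1}" "q3 \<in> {0, 1}" "q4 \<in> {0, 1}"
  shows "finite (patterns q2 q3 q4)" "q2 = 0 \<or> q3 = 0 \<or> q4 = 0 \<Longrightarrow> card (patterns q2 q3 q4) \<le> 4"
  using assms by (auto simp: patterns_def square_roots card_cartesian_product)

lemma card_filter_le_length: "card {a \<in> set xs. P a} \<le> length (filter P xs)"
  by (metis card_length set_filter)

text \<open>If c2, c3, c4 are nonzero, no two solutions differ in just one sign, so four would form
  a parity class of the cube; multiplying each equation by its second sign and adding gives 4 c2 =
  0. If one of them vanishes, its sign is free and at most one choice of the other two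
  works.\<close>

lemma eight_signs:
  fixes c1 c2 c3 c4 :: real
  assumes "\<not> (c1 = 0 \<and> c2 = 0)" "\<not> (c1 = 0 \<and> c3 = 0)" "\<not> (c1 = 0 \<and> c4 = 0)"
      "\<not> (c2 = 0 \<and> c3 = 0)" "\<not> (c2 = 0 \<and> c4 = 0)" "\<not> (c3 = 0 \<and> c4 = 0)"
  shows "of_bool (c1 - c2 - c3 - c4 = 0) + of_bool (c1 - c2 - c3 + c4 = 0)
    + of_bool (c1 - c2 + c3 - c4 = 0) + of_bool (c1 - c2 + c3 + c4 = 0)
    + of_bool (c1 + c2 - c3 - c4 = 0) + of_bool (c1 + c2 - c3 + c4 = 0)
    + of_bool (c1 + c2 + c3 - c4 = 0) + of_bool (c1 + c2 + c3 + c4 = 0) \<le> (3::int)"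
  using assms unfolding of_bool_def by (smt (verit))

lemma length_filter_Cons: "int (length (filter P (x # xs))) = of_bool (P x) + int (length (filter P xs))"
  by simp

text \<open>The equation is a linear relation among the four vectors paired with a solution
  \<open>y\<close> normalized by \<open>lor y x1 = 1\<close>.\<close>

lemma patterns_relation_card:
  assumes q: "q2 \<in> {0, 1}" "q3 \<in> {0, 1}" "q4 \<in> {0, 1}"
    and c: "\<not> (c1 = 0 \<and> c2 = 0)" "\<not> (c1 = 0 \<and> c3 = 0)" "\<not> (c1 = 0 \<and> c4 = 0)"
      "\<not> (c2 = 0 \<and> c3 = 0)" "\<not> (c2 = 0 \<and> c4 = 0)" "\<not> (c3 = 0 \<and> c4 = (0::real))"
  shows "card {(s2, s3, s4) \<in> patterns q2 q3 q4. c1 + c2 * s2 + c3 * s3 + c4 * s4 = 0} \<le> 3"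
proof -
  define P where "P = (\<lambda>(s2, s3, s4). c1 + c2 * s2 + c3 * s3 + c4 * s4 = 0)"
  define r where "r q = (if q = 0 then [0::real] else [-1, 1])" for q :: real
  let ?l = "List.product (r q2) (List.product (r q3) (r q4))"
  have r: "q \<in> {0, 1} \<Longrightarrow> {s. s\<^sup>2 = q} = set (r q)" for q by (auto simp: square_roots r_def)
  have "{(s2, s3, s4) \<in> patterns q2 q3 q4. c1 + c2 * s2 + c3 * s3 + c4 * s4 = 0} = {a \<in> set ?l. P a}"
    using q by (auto simp: patterns_def r P_def)
  moreover have "length (filter P ?l) \<le> 3"
  proof (cases "q2 = 1 \<and> q3 = 1 \<and> q4 = 1")
    case True
    then have "?l = [(-1,-1,-1), (-1,-1,1), (-1,1,-1), (-1,1,1), (1,-1,-1), (1,-1,1), (1,1,-1), (1,1,1)]"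
      by (simp add: r_def)
    then have "int (length (filter P ?l)) = of_bool (c1 - c2 - c3 - c4 = 0) + of_bool (c1 - c2 - c3 + c4 = 0)
      + of_bool (c1 - c2 + c3 - c4 = 0) + of_bool (c1 - c2 + c3 + c4 = 0)
      + of_bool (c1 + c2 - c3 - c4 = 0) + of_bool (c1 + c2 - c3 + c4 = 0)
      + of_bool (c1 + c2 + c3 - c4 = 0) + of_bool (c1 + c2 + c3 + c4 = 0)"
      by (simp only: length_filter_Cons) (simp add: P_def)
    then show ?thesis using eight_signs[OF c] by linarith
  next
    case False
    \<comment> \<open>One zero leaves four patterns, so a single failing one suffices; more zeros
      leave at most two.\<close>
    have "length ?l \<le> 2 \<or> length ?l = 4 \<and> (\<exists>s\<in>set ?l. \<not> P s)"
    proof (rule disjCI)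
      assume *: "\<not> (length ?l = 4 \<and> (\<exists>s\<in>set ?l. \<not> P s))"
      show "length ?l \<le> 2"
      proof (rule ccontr)
        assume "\<not> length ?l \<le> 2"
        then have "q2 = 0 \<and> q3 = 1 \<and> q4 = 1 \<or> q2 = 1 \<and> q3 = 0 \<and> q4 = 1 \<or> q2 = 1 \<and> q3 = 1 \<and> q4 = 0"
          using q False by (elim insertE emptyE) (simp_all add: r_def)
        then consider "q2 = 0" "q3 = 1" "q4 = 1" | "q2 = 1" "q3 = 0" "q4 = 1" | "q2 = 1" "q3 = 1" "q4 = 0"
          by argo
        then show False
        proof cases
          case 1
          then have "?l = [(0,-1,-1), (0,-1,1), (0,1,-1), (0,1,1)]" by (simp add: r_def)
          then have "P (0,-1,-1)" "P (0,1,-1)" "P (0,1,1)" using * by auto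
          then show False using c(2) unfolding P_def prod.case by linarith
        next
          case 2
          then have "?l = [(-1,0,-1), (-1,0,1), (1,0,-1), (1,0,1)]" by (simp add: r_def)
          then have "P (-1,0,-1)" "P (1,0,-1)" "P (1,0,1)" using * by auto
          then show False using c(1) unfolding P_def prod.case by linarith
        next
          case 3
          then have "?l = [(-1,-1,0), (-1,1,0), (1,-1,0), (1,1,0)]" by (simp add: r_def)
          then have "P (-1,-1,0)" "P (1,-1,0)" "P (1,1,0)" using * by auto
          then show False using c(1) unfolding P_def prod.case by linarith
        qed
      qed
    qed
    then show ?thesis using length_filter_le[of P ?l] length_filter_less[of _ ?l P] by (elim disjE conjE bexE) force+
  qed
  ultimately show ?thesis using card_filter_le_length[of ?l P] by (metis (no_types, lifting) le_trans)
qed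

section \<open>Counting\<close>

text \<open>The vectors \<open>v\<close>, \<open>w\<close>, \<open>y\<close> are independent, so
  their complement is a line, spanned by some \<open>z\<close>, and each \<open>x\<close> differs
  from \<open>lor y x *\<^sub>R x1\<close> by a multiple of \<open>z\<close>. Up to sign, three
  distinct unit vectors then lie on the line through \<open>x1\<close> in direction
  \<open>z\<close>, which forces \<open>z\<close> to be null.\<close>

lemma null_if_common_orthogonal_plane:
  assumes A: "finite A" "card A = 4" "inj_on locus A" "x1 \<in> A" "0 \<notin> A"
    and norm: "\<And>x. x \<in> A \<Longrightarrow> lor x x \<in> {0, 1}" and x1: "lor x1 x1 = 1" "lor y x1 = 1"
    and y: "lor y y = 1" "\<And>x. x \<in> A \<Longrightarrow> (lor y x)\<^sup>2 = lor x x"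
    and vw: "\<And>x. x \<in> A \<Longrightarrow> lor v x = 0" "\<And>x. x \<in> A \<Longrightarrow> lor w x = 0"
    and ind: "\<And>\<alpha> \<beta>. \<alpha> *\<^sub>R v + \<beta> *\<^sub>R w = 0 \<Longrightarrow> \<alpha> = 0 \<and> \<beta> = 0"
  obtains z where "z \<noteq> 0" "lor z z = 0" "lor y z = 0" "\<And>x. x \<in> A \<Longrightarrow> lor x z = 0"
proof -
  have "\<alpha> = 0 \<and> \<beta> = 0 \<and> \<gamma> = 0" if eq: "\<alpha> *\<^sub>R v + \<beta> *\<^sub>R w + \<gamma> *\<^sub>R y = 0" for \<alpha> \<beta> \<gamma>
  proof -
    have "lor (\<alpha> *\<^sub>R v + \<beta> *\<^sub>R w + \<gamma> *\<^sub>R y) x1 = 0" using eq by simp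
    then have "\<gamma> = 0" using x1 vw A(4) by (simp add: lor_simps)
    then show ?thesis using eq ind by simp
  qed
  then obtain z where z: "\<And>u. lor v u = 0 \<Longrightarrow> lor w u = 0 \<Longrightarrow> lor y u = 0 \<Longrightarrow> \<exists>t. u = t *\<^sub>R z"
    using orthogonal_three_independent by blast
  have line: "\<exists>t. x = lor y x *\<^sub>R x1 + t *\<^sub>R z" if "x \<in> A" for x
  proof -
    have "\<exists>t. x - lor y x *\<^sub>R x1 = t *\<^sub>R z"
      using that vw A(4) x1 by (intro z) (simp_all add: lor_simps)
    then show ?thesis by (metis diff_add_cancel add.commute)
  qed
  \<comment> \<open>A point of \<open>A\<close> is orthogonal to \<open>y\<close>, hence a multiple
    of \<open>z\<close>. So at most one point occurs, and two unit vectors besides \<open>x1\<close>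
    remain.\<close>
  have one_null: "a = b" if ab: "a \<in> A" "b \<in> A" "lor a a = 0" "lor b b = 0" for a b
  proof -
    have "lor y a = 0" "lor y b = 0" using y(2) ab by fastforce+
    then obtain s t where "a = s *\<^sub>R z" "b = t *\<^sub>R z" using line ab(1,2) by (metis add_0 scaleR_zero_left)
    moreover have "s \<noteq> 0" "t \<noteq> 0" using calculation ab A(5) by auto
    ultimately have "locus a = locus b" using locus_scale by simp
    then show "a = b" using A(3) ab by (simp add: inj_on_eq_iff)
  qed
  have "card (A - {x1}) = 3" using A by simp
  then obtain x2 x3 x4 where A_eq: "A - {x1} = {x2, x3, x4}" "x2 \<noteq> x3" "x2 \<noteq> x4" "x3 \<noteq> x4"
    by (auto simp: card_3_iff)
  then have in_A: "{x2, x3, x4} \<subseteq> A" "x1 \<notin> {x2, x3, x4}" by auto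
  have "\<exists>a b. a \<in> A \<and> b \<in> A \<and> a \<noteq> x1 \<and> b \<noteq> x1 \<and> a \<noteq> b \<and> lor a a \<noteq> 0 \<and> lor b b \<noteq> 0"
  proof (cases "lor x2 x2 = 0")
    case True
    then have "lor x3 x3 \<noteq> 0" "lor x4 x4 \<noteq> 0" using one_null in_A A_eq by blast+
    then show ?thesis using in_A A_eq by blast
  next
    case False
    have "lor x3 x3 \<noteq> 0 \<or> lor x4 x4 \<noteq> 0" using one_null in_A A_eq by blast
    then show ?thesis using False in_A A_eq by blast
  qed
  then obtain a b where ab: "a \<in> A" "b \<in> A" "a \<noteq> x1" "b \<noteq> x1" "a \<noteq> b" "lor a a \<noteq> 0" "lor b b \<noteq> 0"
    by blast
  have unit_ab: "lor a a = 1" "lor b b = 1" using norm[OF ab(1)] norm[OF ab(2)] ab(6,7) by auto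
  have ya: "(lor y a)\<^sup>2 = 1" "(lor y b)\<^sup>2 = 1" using y(2) ab unit_ab by auto
  obtain s t where st: "a = lor y a *\<^sub>R x1 + s *\<^sub>R z" "b = lor y b *\<^sub>R x1 + t *\<^sub>R z" using line ab by metis
  \<comment> \<open>The sign makes the coefficient of \<open>x1\<close> equal to 1.\<close>
  define a' where "a' = lor y a *\<^sub>R a"
  define b' where "b' = lor y b *\<^sub>R b"
  have a': "a' = x1 + (lor y a * s) *\<^sub>R z" and b': "b' = x1 + (lor y b * t) *\<^sub>R z"
    unfolding a'_def b'_def arg_cong[OF st(1), of "scaleR (lor y a)"] arg_cong[OF st(2), of "scaleR (lor y b)"]
    using ya by (simp_all add: scaleR_add_right power2_eq_square)
  have unit': "lor a' a' = 1" "lor b' b' = 1"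
    using ya unit_ab by (simp_all add: a'_def b'_def lor_simps power2_eq_square)
  have nz: "lor y a \<noteq> 0" "lor y b \<noteq> 0" using ya by auto
  then have locus': "locus a' = locus a" "locus b' = locus b" unfolding a'_def b'_def by (simp_all add: locus_scale)
  have ne: "a' \<noteq> x1" "b' \<noteq> x1" "a' \<noteq> b'"
    using locus' ab A(3,4) by (metis inj_onD)+
  define p q where "p = lor y a * s" and "q = lor y b * t"
  have pq: "p \<noteq> 0" "q \<noteq> 0" "p \<noteq> q" using ne a' b' unfolding p_def q_def by auto
  \<comment> \<open>Unit length at the three parameters 0, \<open>p\<close>, \<open>q\<close>: a
    quadratic taking one value three times is constant.\<close>
  have "p * (2 * lor x1 z + p * lor z z) = 0" "q * (2 * lor x1 z + q * lor z z) = 0"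
    using unit' x1 unfolding a' b' p_def[symmetric] q_def[symmetric]
    by (simp_all add: lor_simps lor_commute[of z x1] algebra_simps)
  then have e: "2 * lor x1 z + p * lor z z = 0" "2 * lor x1 z + q * lor z z = 0" using pq by simp_all
  have "(p - q) * lor z z = (2 * lor x1 z + p * lor z z) - (2 * lor x1 z + q * lor z z)"
    by (simp add: algebra_simps)
  then have "(p - q) * lor z z = 0" unfolding e by simp
  then have zz: "lor z z = 0" using pq by simp
  then have x1z: "lor x1 z = 0" using e by simp
  have "z \<noteq> 0" using pq a' ne by auto
  moreover have "lor y z = 0"
  proof -
    have "lor y a' = 1" using ya by (simp add: a'_def lor_simps power2_eq_square)
    then show ?thesis using x1 pq unfolding a' p_def[symmetric] by (simp add: lor_simps)
  qed
  moreover have "lor x z = 0" if "x \<in> A" for x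
  proof -
    obtain r where "x = lor y x *\<^sub>R x1 + r *\<^sub>R z" using line[OF \<open>x \<in> A\<close>] by blast
    then have "lor x z = lor (lor y x *\<^sub>R x1 + r *\<^sub>R z) z" by simp
    then show ?thesis using zz x1z by (simp add: lor_simps)
  qed
  ultimately show thesis using that zz by blast
qed

text \<open>Nondegeneracy makes the pattern determine the vector. A point among the given circles
  leaves four patterns; otherwise seven are impossible.\<close>

lemma count_unit_nondegenerate:
  assumes unit: "lor x1 x1 = 1" and norm: "lor x2 x2 \<in> {0, 1}" "lor x3 x3 \<in> {0, 1}" "lor x4 x4 \<in> {0, 1}"
    and V: "\<And>y. y \<in> V \<longleftrightarrow> lor y y = 1 \<and> lor y x1 = 1 \<and> (lor y x2)\<^sup>2 = lor x2 x2 \<and>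
      (lor y x3)\<^sup>2 = lor x3 x3 \<and> (lor y x4)\<^sup>2 = lor x4 x4"
    and nondeg: "\<And>w. lor w x1 = 0 \<Longrightarrow> lor w x2 = 0 \<Longrightarrow> lor w x3 = 0 \<Longrightarrow> lor w x4 = 0 \<Longrightarrow> w = 0"
  shows "finite V \<and> card V \<le> 6"
proof -
  define pat where "pat y = (lor y x2, lor y x3, lor y x4)" for y
  let ?C = "patterns (lor x2 x2) (lor x3 x3) (lor x4 x4)"
  have sub: "pat ` V \<subseteq> ?C" by (auto simp: pat_def patterns_def V)
  have inj: "inj_on pat V"
  proof (rule inj_onI)
    fix y y' assume "y \<in> V" "y' \<in> V" "pat y = pat y'"
    then have "y - y' = 0" by (intro nondeg) (auto simp: lor_simps V pat_def)
    then show "y = y'" by simp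
  qed
  have fin: "finite ?C" using patterns_card norm by blast
  have finV: "finite V" by (rule finite_imageD[OF finite_subset[OF sub fin] inj])
  have cardV: "card V = card (pat ` V)" using card_image inj by metis
  show ?thesis
  proof (cases "lor x2 x2 = 0 \<or> lor x3 x3 = 0 \<or> lor x4 x4 = 0")
    case True
    then have "card ?C \<le> 4" using patterns_card(2) norm by blast
    then show ?thesis using finV cardV card_mono[OF fin sub] by linarith
  next
    case False
    then have one: "lor x2 x2 = 1" "lor x3 x3 = 1" "lor x4 x4 = 1" using norm by auto
    have C: "?C = {-1, 1} \<times> {-1, 1} \<times> {-1, 1}" by (simp add: patterns_def square_roots one)
    have "card V \<le> 6"
    proof (rule ccontr)
      assume "\<not> card V \<le> 6"
      moreover have "card ?C = 8" by (simp add: C card_cartesian_product)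
      ultimately have "card (?C - pat ` V) \<le> 1"
        using cardV card_Diff_subset[OF finite_subset[OF sub fin] sub] by linarith
      then have "?C - pat ` V = {} \<or> (\<exists>m. ?C - pat ` V = {m})"
        using fin by (metis card_0_eq card_1_singletonE finite_Diff le_less less_one)
      \<comment> \<open>A default choice of \<open>m\<close> in case no pattern is missing.\<close>
      moreover have "(1, 1, 1) \<in> ?C" by (simp add: C)
      ultimately obtain m where m: "m \<in> ?C" "?C - {m} \<subseteq> pat ` V" by blast
      obtain m2 m3 m4 where m_eq: "m = (m2, m3, m4)" by (metis prod_cases3)
      have msq: "m2 * m2 = 1" "m3 * m3 = 1" "m4 * m4 = 1" using m(1) by (auto simp: C m_eq)
      show False
      \<comment> \<open>These factors move the missing pattern \<open>m\<close> to (-1, -1,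
        -1).\<close>
      proof (rule not_seven_patterns[of x1 "(-m2) *\<^sub>R x2" "(-m3) *\<^sub>R x3" "(-m4) *\<^sub>R x4"])
        show "lor x1 x1 = 1" "lor ((-m2) *\<^sub>R x2) ((-m2) *\<^sub>R x2) = 1"
          "lor ((-m3) *\<^sub>R x3) ((-m3) *\<^sub>R x3) = 1" "lor ((-m4) *\<^sub>R x4) ((-m4) *\<^sub>R x4) = 1"
          using unit one msq by (simp_all add: lor_simps)
      next
        fix w assume "lor w x1 = 0" "lor w ((-m2) *\<^sub>R x2) = 0" "lor w ((-m3) *\<^sub>R x3) = 0" "lor w ((-m4) *\<^sub>R x4) = 0"
        moreover have "m2 \<noteq> 0" "m3 \<noteq> 0" "m4 \<noteq> 0" using msq by auto
        ultimately show "w = 0" by (intro nondeg) (simp_all add: lor_simps)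
      next
        fix s2 s3 s4 :: real
        assume s: "{s2, s3, s4} \<subseteq> {-1, 1}" "(s2, s3, s4) \<noteq> (-1, -1, -1)"
        have "(-m2 * s2, -m3 * s3, -m4 * s4) \<in> ?C - {m}"
        proof -
          have "s2\<^sup>2 = 1" "s3\<^sup>2 = 1" "s4\<^sup>2 = 1" using s(1) by auto
          moreover have "m2\<^sup>2 = 1" "m3\<^sup>2 = 1" "m4\<^sup>2 = 1" using msq by (simp_all add: power2_eq_square)
          ultimately have "(-m2 * s2, -m3 * s3, -m4 * s4) \<in> ?C"
            by (simp add: patterns_def one power_mult_distrib)
          moreover have "t = - 1" if "- n * t = n" "n * n = 1" for n t :: real
          proof -
            have "n * (t + 1) = 0" using that(1) by (simp add: algebra_simps)
            moreover have "n \<noteq> 0" using that(2) by auto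
            ultimately show ?thesis by simp
          qed
          ultimately show ?thesis using s(2) msq unfolding m_eq by blast
        qed
        then obtain y where y: "y \<in> V" "pat y = (-m2 * s2, -m3 * s3, -m4 * s4)" using m(2) by fastforce
        have "m2 * (m2 * s2) = s2" "m3 * (m3 * s3) = s3" "m4 * (m4 * s4) = s4"
          using msq by (simp_all only: mult.assoc[symmetric] mult_1_left)
        then show "\<exists>y. lor y y = 1 \<and> lor y x1 = 1 \<and> lor y ((-m2) *\<^sub>R x2) = s2 \<and>
            lor y ((-m3) *\<^sub>R x3) = s3 \<and> lor y ((-m4) *\<^sub>R x4) = s4"
          using y by (intro exI[of _ y]) (simp add: V pat_def lor_simps)
      qed
    qed
    then show ?thesis using finV by blast
  qed
qed

lemma card_le_2_fibres:
  assumes "finite (f ` V)" and "\<And>y. y \<in> V \<Longrightarrow> \<exists>y'. {v \<in> V. f v = f y} \<subseteq> {y, y'}"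
  shows "finite V \<and> card V \<le> 2 * card (f ` V)"
proof -
  have V: "V = (\<Union>s\<in>f ` V. {v \<in> V. f v = s})" by blast
  have fib: "finite {v \<in> V. f v = s} \<and> card {v \<in> V. f v = s} \<le> 2" if s: "s \<in> f ` V" for s
  proof -
    obtain y y' where yy': "{v \<in> V. f v = s} \<subseteq> {y, y'}" using assms(2) s by blast
    have "card {y, y'} \<le> 2" by (simp add: card_insert_if)
    moreover have "card {v \<in> V. f v = s} \<le> card {y, y'}" by (rule card_mono[OF _ yy']) simp
    moreover have "finite {v \<in> V. f v = s}" by (rule finite_subset[OF yy']) simp
    ultimately show ?thesis by linarith
  qed
  then have "finite V" using assms(1) V by (metis (no_types, lifting) finite_UN)
  have "card V \<le> (\<Sum>s\<in>f ` V. card {v \<in> V. f v = s})" using card_UN_le[OF assms(1)] V by metis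
  also have "\<dots> \<le> card (f ` V) * 2" using fib sum_bounded_above[of "f ` V" _ "2::nat"] by force
  finally show ?thesis using \<open>finite V\<close> by simp
qed

text \<open>The linear relation leaves at most three patterns. Vectors with equal pattern differ by
  \<open>t *\<^sub>R v\<close>, and unit length gives an equation for \<open>t\<close> with one root
  if \<open>v\<close> is null and at most two otherwise.\<close>

lemma count_unit_one_dim:
  assumes norm: "lor x2 x2 \<in> {0, 1}" "lor x3 x3 \<in> {0, 1}" "lor x4 x4 \<in> {0, 1}"
    and V: "\<And>y. y \<in> V \<longleftrightarrow> lor y y = 1 \<and> lor y x1 = 1 \<and> (lor y x2)\<^sup>2 = lor x2 x2 \<and>
      (lor y x3)\<^sup>2 = lor x3 x3 \<and> (lor y x4)\<^sup>2 = lor x4 x4"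
    and dist: "distinct [locus x1, locus x2, locus x3, locus x4]" "0 \<notin> {x1, x2, x3, x4}"
    and v: "v \<noteq> 0" "lor v x1 = 0" "lor v x2 = 0" "lor v x3 = 0" "lor v x4 = 0"
    and one_dim: "\<And>w. lor w x1 = 0 \<Longrightarrow> lor w x2 = 0 \<Longrightarrow> lor w x3 = 0 \<Longrightarrow> lor w x4 = 0 \<Longrightarrow> \<exists>t. w = t *\<^sub>R v"
    and no_null: "\<And>y. y \<in> V \<Longrightarrow> lor v v = 0 \<Longrightarrow> lor y v \<noteq> 0"
  shows "finite V" "card V \<le> (if lor v v = 0 then 3 else 6)"
proof -
  obtain c1 c2 c3 c4 where c: "c1 *\<^sub>R x1 + c2 *\<^sub>R x2 + c3 *\<^sub>R x3 + c4 *\<^sub>R x4 = 0"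
    "\<not> (c1 = 0 \<and> c2 = 0 \<and> c3 = 0 \<and> c4 = 0)"
    using four_orthogonal_dependent[OF v] dist(1) by (metis distinct_length_2_or_more distinct_singleton)
  \<comment> \<open>Two vanishing coefficients would leave a relation between two vectors of
    distinct circles.\<close>
  have proportional: "a = 0 \<and> b = 0"
    if "a *\<^sub>R x + b *\<^sub>R y = 0" "locus x \<noteq> locus y" "x \<in> {x1, x2, x3, x4}" "y \<in> {x1, x2, x3, x4}" for a b x y
    using locus_proportional[OF that(1)] that(2,3,4) dist(2) by metis
  have c12: "\<not> (c1 = 0 \<and> c2 = 0)"
    using c proportional[of c3 x3 c4 x4] dist(1) by fastforce
  have c13: "\<not> (c1 = 0 \<and> c3 = 0)"
    using c proportional[of c2 x2 c4 x4] dist(1) by fastforce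
  have c14: "\<not> (c1 = 0 \<and> c4 = 0)"
    using c proportional[of c2 x2 c3 x3] dist(1) by fastforce
  have c23: "\<not> (c2 = 0 \<and> c3 = 0)"
    using c proportional[of c1 x1 c4 x4] dist(1) by fastforce
  have c24: "\<not> (c2 = 0 \<and> c4 = 0)"
    using c proportional[of c1 x1 c3 x3] dist(1) by fastforce
  have c34: "\<not> (c3 = 0 \<and> c4 = 0)"
    using c proportional[of c1 x1 c2 x2] dist(1) by fastforce
  define pat where "pat y = (lor y x2, lor y x3, lor y x4)" for y
  let ?C = "{(s2, s3, s4) \<in> patterns (lor x2 x2) (lor x3 x3) (lor x4 x4). c1 + c2 * s2 + c3 * s3 + c4 * s4 = 0}"
  have sub: "pat ` V \<subseteq> ?C"
  proof (rule image_subsetI)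
    fix y assume y: "y \<in> V"
    have "lor y (c1 *\<^sub>R x1 + c2 *\<^sub>R x2 + c3 *\<^sub>R x3 + c4 *\<^sub>R x4) = 0" by (simp add: c)
    then have "c1 + c2 * lor y x2 + c3 * lor y x3 + c4 * lor y x4 = 0" using y by (simp add: V lor_simps)
    then show "pat y \<in> ?C" using y by (simp add: pat_def patterns_def V)
  qed
  have finC: "finite ?C" by (rule finite_subset[OF _ patterns_card(1)[OF norm]]) auto
  have fin: "finite (pat ` V)" by (rule finite_subset[OF sub finC])
  have card3: "card (pat ` V) \<le> 3"
    by (rule le_trans[OF card_mono[OF finC sub] patterns_relation_card[OF norm c12 c13 c14 c23 c24 c34]])
  have fibre: "\<exists>t. y' = y + t *\<^sub>R v \<and> t * (2 * lor y v + t * lor v v) = 0"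
    if y: "y \<in> V" "y' \<in> V" "pat y' = pat y" for y y'
  proof -
    have "\<exists>t. y' - y = t *\<^sub>R v" using y by (intro one_dim) (auto simp: V pat_def lor_simps)
    then obtain t where "y' = y + t *\<^sub>R v" by (metis add.commute diff_add_cancel)
    moreover have "lor y y = 1" "lor y' y' = 1" using y V by auto
    ultimately have "y' = y + t *\<^sub>R v \<and> t * (2 * lor y v + t * lor v v) = 0"
      by (simp add: lor_simps lor_commute[of v y] algebra_simps)
    then show ?thesis by blast
  qed
  have "finite V \<and> card V \<le> (if lor v v = 0 then 3 else 6)"
  proof (cases "lor v v = 0")
    case True
    have inj: "inj_on pat V"
    proof (rule inj_onI)
      fix y y' assume "y \<in> V" "y' \<in> V" "pat y = pat y'"
      then obtain t where "y' = y + t *\<^sub>R v" "t * (2 * lor y v + t * lor v v) = 0" using fibre by metis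
      then show "y = y'" using True no_null[OF \<open>y \<in> V\<close>] by simp
    qed
    then show ?thesis using True card3 card_image[OF inj] finite_imageD[OF fin inj] by simp
  next
    case False
    have "finite V \<and> card V \<le> 2 * card (pat ` V)"
    proof (rule card_le_2_fibres[OF fin])
      fix y assume y: "y \<in> V"
      \<comment> \<open>The second root is the reflection of \<open>y\<close> in the hyperplane
        orthogonal to \<open>v\<close>.\<close>
      have "{w \<in> V. pat w = pat y} \<subseteq> {y, y + (- 2 * lor y v / lor v v) *\<^sub>R v}"
      proof
        fix w assume "w \<in> {w \<in> V. pat w = pat y}"
        then obtain t where t: "w = y + t *\<^sub>R v" "t * (2 * lor y v + t * lor v v) = 0" using fibre y by blast
        then have "t = 0 \<or> t * lor v v = - 2 * lor y v" by auto
        then have "t = 0 \<or> t = - 2 * lor y v / lor v v" using False by (metis nonzero_mult_div_cancel_right)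
        then show "w \<in> {y, y + (- 2 * lor y v / lor v v) *\<^sub>R v}" using t(1) by auto
      qed
      then show "\<exists>y'. {w \<in> V. pat w = pat y} \<subseteq> {y, y'}" by blast
    qed
    then show ?thesis using False card3 by simp
  qed
  then show "finite V" "card V \<le> (if lor v v = 0 then 3 else 6)" by auto
qed

text \<open>The alternatives leave room for solutions that are points: such a point lies on all
  given curves. Either there are none, or the bound 3 applies.\<close>

lemma count_unit:
  assumes unit: "lor x1 x1 = 1" and norm: "lor x2 x2 \<in> {0, 1}" "lor x3 x3 \<in> {0, 1}" "lor x4 x4 \<in> {0, 1}"
    and V: "\<And>y. y \<in> V \<longleftrightarrow> lor y y = 1 \<and> lor y x1 = 1 \<and> (lor y x2)\<^sup>2 = lor x2 x2 \<and>
      (lor y x3)\<^sup>2 = lor x3 x3 \<and> (lor y x4)\<^sup>2 = lor x4 x4"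
    and dist: "distinct [locus x1, locus x2, locus x3, locus x4]" "0 \<notin> {x1, x2, x3, x4}"
    and no_null: "\<And>y z. y \<in> V \<Longrightarrow> z \<noteq> 0 \<Longrightarrow> lor z z = 0 \<Longrightarrow> lor y z = 0 \<Longrightarrow>
      \<exists>x\<in>{x1, x2, x3, x4}. lor x z \<noteq> 0"
  shows "finite V \<and> (card V \<le> 3 \<or> card V \<le> 6 \<and> (\<nexists>P. \<forall>x\<in>{x1, x2, x3, x4}. P \<in> locus x))"
proof -
  let ?A = "{x1, x2, x3, x4}" and ?N = "\<lambda>w. lor w x1 = 0 \<and> lor w x2 = 0 \<and> lor w x3 = 0 \<and> lor w x4 = 0"
  have locusN: "(\<forall>x\<in>?A. P \<in> locus x) \<longleftrightarrow> ?N (pt P)" for P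
    by (simp add: locus_def lor_commute[of _ "pt P"])
  \<comment> \<open>The common complement has dimension 0, 1 or at least 2.\<close>
  consider (zero) "\<And>w. ?N w \<Longrightarrow> w = 0"
    | (one) v where "v \<noteq> 0" "?N v" "\<And>w. ?N w \<Longrightarrow> \<exists>t. w = t *\<^sub>R v"
    | (two) v w where "v \<noteq> 0" "?N v" "?N w" "\<nexists>t. w = t *\<^sub>R v" by metis
  then show ?thesis
  proof cases
    case zero
    then have "finite V \<and> card V \<le> 6" by (intro count_unit_nondegenerate[OF unit norm V]) blast+
    moreover have "\<nexists>P. \<forall>x\<in>?A. P \<in> locus x" unfolding locusN using zero pt_nonzero by blast
    ultimately show ?thesis by blast
  next
    case one
    have nn: "lor y v \<noteq> 0" if "y \<in> V" "lor v v = 0" for y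
      using no_null[OF that(1) one(1) that(2)] one(2) by (auto simp: lor_commute)
    have fc: "finite V" "card V \<le> (if lor v v = 0 then 3 else 6)"
      using count_unit_one_dim[OF norm V dist one(1) _ _ _ _ one(3) nn] one(2) by blast+
    show ?thesis
    proof (cases "lor v v = 0")
      case False
      \<comment> \<open>The complement is spanned by a vector that is not null, so it contains no
        point.\<close>
      have "\<not> ?N (pt P)" for P
      proof
        assume "?N (pt P)"
        then obtain t where t: "pt P = t *\<^sub>R v" using one(3) by blast
        then have "t * t * lor v v = 0" using lor_pt_self[of P] by (simp add: lor_simps)
        then show False using False t pt_nonzero[of P] by auto
      qed
      then show ?thesis using fc False locusN by simp
    qed (use fc in simp)
  next
    case two
    have ind: "\<alpha> = 0 \<and> \<beta> = 0" if "\<alpha> *\<^sub>R v + \<beta> *\<^sub>R w = 0" for \<alpha> \<beta>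
    proof (cases "\<beta> = 0")
      case False
      have "\<beta> *\<^sub>R w = (- \<alpha>) *\<^sub>R v" using that by (simp add: eq_neg_iff_add_eq_0 add.commute)
      then have "w = (- \<alpha> / \<beta>) *\<^sub>R v" using False
        by (metis divide_inverse_commute scaleR_scaleR scaleR_one left_inverse)
      then show ?thesis using two(4) by blast
    qed (use that two(1) in simp)
    have "y \<notin> V" for y
    proof
      assume y: "y \<in> V"
      have "distinct [x1, x2, x3, x4]" using dist(1) by auto
      then have A: "finite ?A" "card ?A = 4" "x1 \<in> ?A" by simp_all
      have inj: "inj_on locus ?A" using dist(1) by (simp add: inj_on_def eq_commute)
      obtain z where "z \<noteq> 0" "lor z z = 0" "lor y z = 0" "\<And>x. x \<in> ?A \<Longrightarrow> lor x z = 0"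
        by (rule null_if_common_orthogonal_plane[OF A(1,2) inj A(3) dist(2), of y v w]) (use unit norm y V two ind in auto)
      then show False using no_null y by blast
    qed
    then have "V = {}" by blast
    then show ?thesis by simp
  qed
qed

section \<open>Assembling the bound\<close>

lemma card_le_2I:
  assumes "\<And>a b c. {a, b, c} \<subseteq> A \<Longrightarrow> a \<noteq> b \<Longrightarrow> a \<noteq> c \<Longrightarrow> b \<noteq> c \<Longrightarrow> False"
  shows "finite A" "card A \<le> 2"
proof -
  have *: "\<not> (B \<subseteq> A \<and> card B = 3)" for B using assms by (metis card_3_iff)
  show "finite A" using * infinite_arbitrarily_large[of A 3] by blast
  show "card A \<le> 2"
  proof (rule ccontr)
    assume "\<not> card A \<le> 2"
    then have "3 \<le> card A" by simp
    then show False using * obtain_subset_with_card_n by metis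
  qed
qed

theorem mainTheorem1:
  fixes S :: "ext_plane set set"
  assumes "card S = 4"
    and "\<And>X. X \<in> S \<Longrightarrow> gen_circle X"
    and "\<not> all_tangent_at_one_point S"
  shows "finite {Y. gen_circle Y \<and> (\<forall>X\<in>S. tangent Y X)} \<and>
         card {Y. gen_circle Y \<and> (\<forall>X\<in>S. tangent Y X)} \<le> 6"
proof -
  let ?T = "{Y. gen_circle Y \<and> (\<forall>X\<in>S. tangent Y X)}"
  obtain f where f: "\<And>X. X \<in> S \<Longrightarrow> represents (f X) X" using represents_exists assms(2) by metis
  have locus_f: "\<And>X. X \<in> S \<Longrightarrow> locus (f X) = X" using f by (simp add: represents_def)
  have sol: "\<exists>y. represents y Y \<and> Y = locus y \<and> (\<forall>X\<in>S. (lor y (f X))\<^sup>2 = lor y y * lor (f X) (f X) \<and>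
      (lor y y = 1 \<or> lor (f X) (f X) = 1))" if "Y \<in> ?T" for Y
  proof -
    obtain y where y: "represents y Y" using represents_exists \<open>Y \<in> ?T\<close> by blast
    moreover have "Y = locus y" using y by (simp add: represents_def)
    ultimately show ?thesis using tangent_lor[OF _ y f] that by blast
  qed
  show ?thesis
  proof (cases "\<exists>X\<in>S. lor (f X) (f X) = 1")
    case True
    then obtain X1 where X1: "X1 \<in> S" "lor (f X1) (f X1) = 1" by blast
    have "card (S - {X1}) = 3" using assms(1) X1(1) by simp
    then obtain X2 X3 X4 where X: "S - {X1} = {X2, X3, X4}" "X2 \<noteq> X3" "X2 \<noteq> X4" "X3 \<noteq> X4"
      by (auto simp: card_3_iff)
    then have S: "S = {X1, X2, X3, X4}" using X1(1) by blast
    have X1n: "X1 \<noteq> X2" "X1 \<noteq> X3" "X1 \<noteq> X4" using X(1) by auto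
    \<comment> \<open>As \<open>X1\<close> is not a point, the condition
      \<open>lor y (f X1) = 1\<close> fixes the sign of a unit vector representing a
      solution.\<close>
    define V where "V = {y. lor y y = 1 \<and> lor y (f X1) = 1 \<and> (lor y (f X2))\<^sup>2 = lor (f X2) (f X2) \<and>
      (lor y (f X3))\<^sup>2 = lor (f X3) (f X3) \<and> (lor y (f X4))\<^sup>2 = lor (f X4) (f X4)}"
    have norm: "lor (f X) (f X) \<in> {0, 1}" if "X \<in> S" for X using represents_norm f that by blast
    have V_iff: "y \<in> V \<longleftrightarrow> lor y y = 1 \<and> lor y (f X1) = 1 \<and> (\<forall>X\<in>S. (lor y (f X))\<^sup>2 = lor (f X) (f X))" for y
      using X1(2) by (auto simp: V_def S)
    have count: "finite V \<and> (card V \<le> 3 \<or> card V \<le> 6 \<and> (\<nexists>P. \<forall>x\<in>{f X1, f X2, f X3, f X4}. P \<in> locus x))"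
    proof (rule count_unit)
      show "distinct [locus (f X1), locus (f X2), locus (f X3), locus (f X4)]"
        using X X1n locus_f S by simp
      have "0 \<noteq> f X" if "X \<in> S" for X using represents_nonzero[OF f[OF that]] by (rule not_sym)
      then show "0 \<notin> {f X1, f X2, f X3, f X4}" unfolding S by blast
    next
      fix y z assume yz: "y \<in> V" "z \<noteq> 0" "lor z z = 0" "lor y z = 0"
      \<comment> \<open>Otherwise all four would be tangent at the point of
        \<open>z\<close>.\<close>
      then show "\<exists>x\<in>{f X1, f X2, f X3, f X4}. lor x z \<noteq> 0"
        using all_tangent_if_null_orthogonal[of z y S f] f assms(3) V_iff S by blast
    next
      show "y \<in> V \<longleftrightarrow> lor y y = 1 \<and> lor y (f X1) = 1 \<and> (lor y (f X2))\<^sup>2 = lor (f X2) (f X2) \<and>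
        (lor y (f X3))\<^sup>2 = lor (f X3) (f X3) \<and> (lor y (f X4))\<^sup>2 = lor (f X4) (f X4)" for y
        by (simp add: V_def)
    qed (use norm[of X2] norm[of X3] norm[of X4] S X1(2) in \<open>simp_all only: insert_iff simp_thms\<close>)
    have T_sub: "Y \<in> locus ` V \<or> (\<exists>P. Y = {P} \<and> (\<forall>X\<in>S. P \<in> locus (f X) \<and> lor (f X) (f X) = 1))"
      if Y: "Y \<in> ?T" for Y
    proof -
      obtain y where y: "represents y Y" "Y = locus y" "\<forall>X\<in>S. (lor y (f X))\<^sup>2 = lor y y * lor (f X) (f X) \<and>
        (lor y y = 1 \<or> lor (f X) (f X) = 1)" using sol Y by blast
      show ?thesis
      proof (cases "lor y y = 1")
        case True
        define s where "s = lor y (f X1)"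
        have s: "s * s = 1" using y(3) X1 True by (simp add: s_def power2_eq_square)
        have "s *\<^sub>R y \<in> V" unfolding V_iff
          using True y(3) s by (simp add: lor_simps power_mult_distrib power2_eq_square[of s] s_def[symmetric])
        moreover have "s \<noteq> 0" using s by auto
        then have "locus (s *\<^sub>R y) = Y" using y(2) locus_scale by simp
        ultimately show ?thesis by blast
      next
        case False
        then have "lor y y = 0" using represents_norm y(1) by blast
        then obtain P where P: "y = pt P" "Y = {P}" using represents_null y(1) by blast
        then show ?thesis using y(3) by (auto simp: locus_def lor_commute[of "pt P"])
      qed
    qed
    \<comment> \<open>Candidates for solutions that are points; since two points are never tangent,
      all given circles must then be curves.\<close>
    define B where "B = {P. \<forall>X\<in>S. P \<in> locus (f X) \<and> lor (f X) (f X) = 1}"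
    have B: "finite B" "card B \<le> 2"
    proof -
      \<comment> \<open>Three common points would make two of the given curves equal.\<close>
      have False if "{P, Q, R} \<subseteq> B" "P \<noteq> Q" "P \<noteq> R" "Q \<noteq> R" for P Q R
      proof -
        have "locus (f X1) = locus (f X2)"
          using that by (intro locus_eq_if_three_points[of _ _ P Q R]) (auto simp: B_def S)
        then show False using X1n(1) locus_f S by simp
      qed
      then show "finite B" "card B \<le> 2" using card_le_2I by metis+
    qed
    have sub: "?T \<subseteq> locus ` V \<union> (\<lambda>P. {P}) ` B" using T_sub by (auto simp: B_def)
    have fin: "finite (locus ` V \<union> (\<lambda>P. {P}) ` B)" using conjunct1[OF count] B(1) by simp
    have "card (locus ` V \<union> (\<lambda>P. {P}) ` B) \<le> card V + card B"
      using card_Un_le card_image_le[OF conjunct1[OF count]] card_image_le[OF B(1)] by (metis add_mono le_trans)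
    \<comment> \<open>The total is at most 6 + 0 or 3 + 2.\<close>
    moreover have "card V \<le> 6 \<and> B = {} \<or> card V \<le> 3"
      using conjunct2[OF count] S by (auto simp: B_def)
    ultimately have "card (locus ` V \<union> (\<lambda>P. {P}) ` B) \<le> 6" using B(2) by auto
    then show ?thesis using sub fin finite_subset card_mono le_trans by meson
  next
    case False
    \<comment> \<open>All given circles are points. A solution is then a curve through three of
      them, so there is at most one.\<close>
    obtain S' where "S' \<subseteq> S" "card S' = 3" using obtain_subset_with_card_n[of 3 S] assms(1) by auto
    then obtain X1 X2 X3 where X: "{X1, X2, X3} \<subseteq> S" "X1 \<noteq> X2" "X1 \<noteq> X3" "X2 \<noteq> X3"
      by (metis card_3_iff)
    have pt: "\<exists>P. f X = pt P \<and> X = {P}" if "X \<in> S" for X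
      using represents_null[OF f[OF that]] represents_norm[OF f[OF that]] False that by metis
    obtain P Q R where PQR: "f X1 = pt P" "X1 = {P}" "f X2 = pt Q" "X2 = {Q}" "f X3 = pt R" "X3 = {R}"
      using pt X(1) by (metis insert_subset)
    have T: "\<exists>y. Y = locus y \<and> lor y y = 1 \<and> {P, Q, R} \<subseteq> locus y" if Y: "Y \<in> ?T" for Y
    proof -
      obtain y where y: "Y = locus y" "\<forall>X\<in>S. (lor y (f X))\<^sup>2 = lor y y * lor (f X) (f X) \<and>
        (lor y y = 1 \<or> lor (f X) (f X) = 1)" using sol Y by blast
      then have "lor y y = 1" using X(1) False by blast
      moreover have "{P, Q, R} \<subseteq> locus y" using y(2) X(1) PQR by (auto simp: locus_def)
      ultimately show ?thesis using y(1) by blast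
    qed
    have "Y = Y'" if "Y \<in> ?T" "Y' \<in> ?T" for Y Y'
      using T[OF that(1)] T[OF that(2)] locus_eq_if_three_points[of _ _ P Q R] X PQR by metis
    then have "?T = {} \<or> (\<exists>Y. ?T = {Y})" by blast
    then show ?thesis by (metis (no_types, lifting) card.empty card_1_singleton_iff finite.emptyI finite.insertI is_singletonI is_singleton_altdef le0 one_le_numeral)
  qed
qed

end
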